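(* Let $\alpha,\beta\in(0,1/2)$, and consider the distributed sequential test described in the context. Let $k=Nr^2$ and suppose that for each $i=1,\dots,N$ the thresholds satisfy $$\gamma_{d,i}^{h}\ \ge\ \frac{8(k+1)}{7N}\left(\log\left(\frac{2}{\alpha}\right)-\log\left(1-e^{-\frac{Nm}{4(k+1)}}\right)\right),\qquad \gamma_{d,i}^{l}\ \le\ \frac{8(k+1)}{7N}\left(\log\left(\frac{\beta}{2}\right)+\log\left(1-e^{-\frac{Nm}{4(k+1)}}\right)\right).$$ Then $$\limsup_{t\to\infty}\frac1t\log\big(\mathbb{P}_1(T_{d,i}>t)\big)\le-\frac{Nm}{4},\qquad\forall i=1,2,\dots,N.$$
   Context: Observation model: there are $N$ agents; at each time $t=1,2,\dots$ agent $i$ observes $y_i(t)=\mu_\theta+n_i(t)$ under hypothesis $H_\theta$, $\theta\in\{0,1\}$, with $\mu_1=\mu$, $\mu_0=-\mu$, $\mu\neq 0$. The noises $n_i(t)$ are independent over all agents $i$ and times $t$, each Gaussian with mean $0$ and variance $\sigma^2>0$, under both hypotheses. $\mathbb{P}_\theta$ denotes probability under $H_\theta$. The log-likelihood ratio at agent $i$ is $\eta_i(t)=2\mu y_i(t)/\sigma^2$, and $\boldsymbol\eta(t)=(\eta_1(t),\dots,\eta_N(t))^\top$. Put $m=2\mu^2/\sigma^2$; thus $\eta_i(t)\sim\mathcal N(m,2m)$ under $H_1$ and $\mathcal N(-m,2m)$ under $H_0$ (mean, variance). Network: $G=(V,E)$ is a connected simple undirected graph on the agents $V=\{1,\dots,N\}$.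 $\mathbf W=[w_{ij}]$ is an $N\times N$ non-negative, symmetric, irreducible, stochastic (rows sum to one) matrix with $w_{ij}=0$ whenever $i\ne j$ and $(i,j)\notin E$. Let $\mathbf J=\frac1N\mathbf 1\mathbf 1^\top$ and $r=\|\mathbf W-\mathbf J\|$ (induced $\mathcal L_2$ norm), and assume $r<1$. Test: the vector of agent statistics $\mathbf S_d(t)=(S_{d,1}(t),\dots,S_{d,N}(t))^\top$ is given by $\mathbf S_d(0)=\mathbf 0$ and $\mathbf S_d(t+1)=\mathbf W(\mathbf S_d(t)+\boldsymbol\eta(t+1))$, i.e. $S_{d,i}(t)=\sum_{j=1}^t\mathbf e_i^\top\mathbf W^{t+1-j}\boldsymbol\eta(j)$. Given thresholds $\gamma_{d,i}^l,\gamma_{d,i}^h\in\mathbb R$, the stopping time of agent $i$ is $T_{d,i}=\inf\{t\ge1: S_{d,i}(t)\notin[\gamma_{d,i}^l,\gamma_{d,i}^h]\}$. $\log$ is the natural logarithm (with $\log 0=-\infty$). *)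

theory Defs
  imports "HOL-Probability.Probability"
begin

definition hyp_mean :: "real \<Rightarrow> nat \<Rightarrow> real" where
  "hyp_mean \<mu> \<theta> = (if \<theta> = 1 then \<mu> else - \<mu>)"

text \<open>Both hypotheses live on one measurable space and share the observations \<open>y i t\<close>; only the
  measure \<open>P \<theta>\<close> changes, for \<open>\<theta>\<close> in \<open>{0, 1}\<close>. The noise under \<open>H\<^sub>\<theta>\<close> is therefore
  \<open>y i t - \<mu>\<^sub>\<theta>\<close>. Observation times start at 1.\<close>

definition gaussian_observations ::
  "(nat \<Rightarrow> 'a measure) \<Rightarrow> real \<Rightarrow> real \<Rightarrow> ('n::finite \<Rightarrow> nat \<Rightarrow> 'a \<Rightarrow> real) \<Rightarrow> bool" where
  "gaussian_observations P \<mu> \<sigma> y \<longleftrightarrow>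
     sets (P 0) = sets (P 1) \<and>
     (\<forall>\<theta>\<in>{0, 1}.
        prob_space (P \<theta>) \<and>
        prob_space.indep_vars (P \<theta>) (\<lambda>_. borel)
          (\<lambda>(i, t) \<omega>. y i t \<omega> - hyp_mean \<mu> \<theta>) (UNIV \<times> {1..}) \<and>
        (\<forall>i. \<forall>t\<ge>1. distributed (P \<theta>) lborel
          (\<lambda>\<omega>. y i t \<omega> - hyp_mean \<mu> \<theta>) (\<lambda>x. ennreal (normal_density 0 \<sigma> x))))"

definition connected_simple_graph :: "('n \<times> 'n) set \<Rightarrow> bool" where
  "connected_simple_graph E \<longleftrightarrow> sym E \<and> irrefl E \<and> (\<forall>i j. (i, j) \<in> E\<^sup>*)"

text \<open>No simultaneous permutation of rows and columns brings the matrix into block triangular form;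
  \<open>S\<close> is the index set of the diagonal block whose rows vanish outside that block.\<close>

definition irreducible_matrix :: "real^'n^'n \<Rightarrow> bool" where
  "irreducible_matrix W \<longleftrightarrow>
     \<not> (\<exists>S. S \<noteq> {} \<and> S \<noteq> UNIV \<and> (\<forall>i\<in>S. \<forall>j\<in>- S. W $ i $ j = 0))"

definition consensus_weights :: "('n::finite \<times> 'n) set \<Rightarrow> real^'n^'n \<Rightarrow> bool" where
  "consensus_weights E W \<longleftrightarrow>
     (\<forall>i j. 0 \<le> W $ i $ j) \<and>
     transpose W = W \<and>
     irreducible_matrix W \<and>
     (\<forall>i. (\<Sum>j\<in>UNIV. W $ i $ j) = 1) \<and>
     (\<forall>i j. i \<noteq> j \<longrightarrow> (i, j) \<notin> E \<longrightarrow> W $ i $ j = 0)"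

definition averaging_matrix :: "real^'n^'n::finite" where
  "averaging_matrix = (\<chi> i j. 1 / real CARD('n))"

definition llr :: "real \<Rightarrow> real \<Rightarrow> ('n::finite \<Rightarrow> nat \<Rightarrow> 'a \<Rightarrow> real) \<Rightarrow> nat \<Rightarrow> 'a \<Rightarrow> real^'n" where
  "llr \<mu> \<sigma> y t \<omega> = (\<chi> i. 2 * \<mu> * y i t \<omega> / \<sigma>\<^sup>2)"

primrec dist_stat ::
  "real^'n^'n::finite \<Rightarrow> (nat \<Rightarrow> 'a \<Rightarrow> real^'n) \<Rightarrow> nat \<Rightarrow> 'a \<Rightarrow> real^'n" where
  "dist_stat W \<eta> 0 \<omega> = 0"
| "dist_stat W \<eta> (Suc t) \<omega> = W *v (dist_stat W \<eta> t \<omega> + \<eta> (Suc t) \<omega>)"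

text \<open>Infimum in \<open>enat\<close>, so the value is \<open>\<infinity>\<close> if the statistic never leaves the interval.\<close>

definition agent_stopping_time ::
  "(nat \<Rightarrow> 'a \<Rightarrow> real^'n::finite) \<Rightarrow> ('n \<Rightarrow> real) \<Rightarrow> ('n \<Rightarrow> real) \<Rightarrow> 'n \<Rightarrow> 'a \<Rightarrow> enat" where
  "agent_stopping_time S \<gamma>l \<gamma>h i \<omega> = Inf {enat t | t. 1 \<le> t \<and> S t \<omega> $ i \<notin> {\<gamma>l i..\<gamma>h i}}"

text \<open>Needed because \<open>ln 0 = 0\<close> on the reals. Only applied to non-negative arguments.\<close>

definition elog :: "real \<Rightarrow> ereal" where
  "elog x = (if x \<le> 0 then - \<infinity> else ereal (ln x))"

end

theory Submission
  imports Defs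
begin

text \<open>If agent \<open>i\<close> has not stopped by time \<open>t\<close>, then \<open>S\<^sub>i(t) \<le> \<gamma>h i\<close>. Expanding the recursion,
  \<open>S\<^sub>i(t)\<close> is the sum of the inner products of \<open>u\<^sub>n = W\<^sup>n e\<^sub>i\<close>, \<open>n = 1, \<dots>, t\<close>, with independent
  Gaussian vectors. The entries of \<open>u\<^sub>n\<close> sum to one, and \<open>u\<^sub>n\<close> approaches the vector with entries
  \<open>1/N\<close> at the geometric rate \<open>r\<^sup>n\<close>, so under \<open>H\<^sub>1\<close> the mean of \<open>S\<^sub>i(t)\<close> is \<open>m t\<close> and its variance
  exceeds \<open>2 m t / N\<close> by at most a constant. The Chernoff bound with exponent \<open>- N/2\<close> then gives
  \<open>P\<^sub>1(T > t) \<le> exp (C - N m t / 4)\<close>.\<close>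

lemma normal_density_mult_exp:
  assumes "\<sigma> > 0"
  shows "normal_density \<mu> \<sigma> x * exp (a * x) =
    exp (a * \<mu> + a\<^sup>2 * \<sigma>\<^sup>2 / 2) * normal_density (\<mu> + a * \<sigma>\<^sup>2) \<sigma> x"
proof -
  have complete_square: "- (x - \<mu>)\<^sup>2 / (2 * \<sigma>\<^sup>2) + a * x =
      a * \<mu> + a\<^sup>2 * \<sigma>\<^sup>2 / 2 + - (x - (\<mu> + a * \<sigma>\<^sup>2))\<^sup>2 / (2 * \<sigma>\<^sup>2)"
    using assms by (simp add: field_simps power2_eq_square)
  have "exp (- (x - \<mu>)\<^sup>2 / (2 * \<sigma>\<^sup>2)) * exp (a * x) =
      exp (a * \<mu> + a\<^sup>2 * \<sigma>\<^sup>2 / 2) * exp (- (x - (\<mu> + a * \<sigma>\<^sup>2))\<^sup>2 / (2 * \<sigma>\<^sup>2))"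
    by (simp only: exp_add[symmetric] complete_square)
  then show ?thesis
    by (simp add: normal_density_def)
qed

lemma
  fixes a :: real
  assumes X: "distributed M lborel X (normal_density \<mu> \<sigma>)" and "\<sigma> > 0"
  shows integrable_exp_normal: "integrable M (\<lambda>\<omega>. exp (a * X \<omega>))"
    and integral_exp_normal: "(\<integral>\<omega>. exp (a * X \<omega>) \<partial>M) = exp (a * \<mu> + a\<^sup>2 * \<sigma>\<^sup>2 / 2)"
  using distributed_integrable[OF X, of "\<lambda>x. exp (a * x)"]
    distributed_integral[OF X, of "\<lambda>x. exp (a * x)"] \<open>\<sigma> > 0\<close>
  by (simp_all add: normal_density_mult_exp)

context prob_space
begin

lemma
  fixes a :: "'i \<Rightarrow> real"
  assumes I: "finite I" and indep: "indep_vars (\<lambda>_. borel) X I"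
    and \<sigma>: "\<And>j. j \<in> I \<Longrightarrow> \<sigma> j > 0"
    and X: "\<And>j. j \<in> I \<Longrightarrow> distributed M lborel (X j) (normal_density (\<mu> j) (\<sigma> j))"
  shows integrable_exp_sum_indep_normal: "integrable M (\<lambda>\<omega>. exp (\<Sum>j\<in>I. a j * X j \<omega>))"
    and expectation_exp_sum_indep_normal: "expectation (\<lambda>\<omega>. exp (\<Sum>j\<in>I. a j * X j \<omega>)) =
      exp ((\<Sum>j\<in>I. a j * \<mu> j) + (\<Sum>j\<in>I. (a j * \<sigma> j)\<^sup>2) / 2)"
proof -
  have indep_exp: "indep_vars (\<lambda>_. borel) (\<lambda>j \<omega>. exp (a j * X j \<omega>)) I"
    by (rule indep_vars_compose2[OF indep]) measurable
  have integrable: "integrable M (\<lambda>\<omega>. exp (a j * X j \<omega>))" if "j \<in> I" for j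
    by (rule integrable_exp_normal[OF X \<sigma>]) fact+
  show "integrable M (\<lambda>\<omega>. exp (\<Sum>j\<in>I. a j * X j \<omega>))"
    using indep_vars_integrable[OF I indep_exp integrable] by (simp add: exp_sum I)
  have "expectation (\<lambda>\<omega>. exp (\<Sum>j\<in>I. a j * X j \<omega>)) =
      (\<Prod>j\<in>I. expectation (\<lambda>\<omega>. exp (a j * X j \<omega>)))"
    using indep_vars_lebesgue_integral[OF I indep_exp integrable] by (simp add: exp_sum I)
  also have "\<dots> = (\<Prod>j\<in>I. exp (a j * \<mu> j + (a j * \<sigma> j)\<^sup>2 / 2))"
    by (intro prod.cong refl) (simp add: integral_exp_normal[OF X \<sigma>] power_mult_distrib)
  finally show "expectation (\<lambda>\<omega>. exp (\<Sum>j\<in>I. a j * X j \<omega>)) =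
      exp ((\<Sum>j\<in>I. a j * \<mu> j) + (\<Sum>j\<in>I. (a j * \<sigma> j)\<^sup>2) / 2)"
    by (simp add: exp_sum[symmetric] I sum.distrib sum_divide_distrib)
qed

lemma Chernoff_indep_normal_le:
  fixes a :: "'i \<Rightarrow> real" and l c :: real
  assumes I: "finite I" and indep: "indep_vars (\<lambda>_. borel) X I"
    and \<sigma>: "\<And>j. j \<in> I \<Longrightarrow> \<sigma> j > 0"
    and X: "\<And>j. j \<in> I \<Longrightarrow> distributed M lborel (X j) (normal_density (\<mu> j) (\<sigma> j))"
    and "l > 0"
  shows "prob {\<omega> \<in> space M. (\<Sum>j\<in>I. a j * X j \<omega>) \<le> c} \<le>
    exp (l * (c - (\<Sum>j\<in>I. a j * \<mu> j)) + l\<^sup>2 / 2 * (\<Sum>j\<in>I. (a j * \<sigma> j)\<^sup>2))"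
proof -
  let ?Y = "\<lambda>\<omega>. \<Sum>j\<in>I. a j * X j \<omega>"
  have scale: "- l * ?Y \<omega> = (\<Sum>j\<in>I. (- l * a j) * X j \<omega>)" for \<omega>
    by (simp add: sum_distrib_left mult.assoc)
  have integrable: "integrable M (\<lambda>\<omega>. exp (- l * ?Y \<omega>))"
    unfolding scale by (rule integrable_exp_sum_indep_normal[OF I indep \<sigma> X])
  have "expectation (\<lambda>\<omega>. exp (- l * ?Y \<omega>)) =
      exp ((\<Sum>j\<in>I. (- l * a j) * \<mu> j) + (\<Sum>j\<in>I. ((- l * a j) * \<sigma> j)\<^sup>2) / 2)"
    unfolding scale by (rule expectation_exp_sum_indep_normal[OF I indep \<sigma> X])
  also have "\<dots> = exp (- l * (\<Sum>j\<in>I. a j * \<mu> j) + l\<^sup>2 / 2 * (\<Sum>j\<in>I. (a j * \<sigma> j)\<^sup>2))"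
    by (simp add: sum_distrib_left sum_divide_distrib power_mult_distrib sum_negf mult.assoc)
  finally have mgf: "expectation (\<lambda>\<omega>. exp (- l * ?Y \<omega>)) = \<dots>" .
  have "prob {\<omega> \<in> space M. ?Y \<omega> \<le> c} \<le> exp (l * c) * expectation (\<lambda>\<omega>. exp (- l * ?Y \<omega>))"
    using Chernoff_ineq_le[OF \<open>l > 0\<close>, of "space M" ?Y c] integrable
    by (simp add: set_integrable_def set_integral_space cong: Bochner_Integration.integrable_cong)
  also have "\<dots> = exp (l * (c - (\<Sum>j\<in>I. a j * \<mu> j)) + l\<^sup>2 / 2 * (\<Sum>j\<in>I. (a j * \<sigma> j)\<^sup>2))"
    unfolding mgf by (simp add: exp_add[symmetric] right_diff_distrib)
  finally show ?thesis .
qed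

end

lemma inner_dist_stat:
  fixes W :: "real^'n^'n"
  shows "v \<bullet> dist_stat W \<eta> t \<omega> = (\<Sum>s = 1..t. ((\<lambda>x. x v* W) ^^ (Suc t - s)) v \<bullet> \<eta> s \<omega>)"
proof (induction t arbitrary: v)
  case (Suc t)
  have "v \<bullet> dist_stat W \<eta> (Suc t) \<omega> = (v v* W) \<bullet> dist_stat W \<eta> t \<omega> + (v v* W) \<bullet> \<eta> (Suc t) \<omega>"
    by (simp add: dot_lmul_matrix[symmetric] inner_add_right)
  also have "(v v* W) \<bullet> dist_stat W \<eta> t \<omega> =
      (\<Sum>s = 1..t. ((\<lambda>x. x v* W) ^^ (Suc (Suc t) - s)) v \<bullet> \<eta> s \<omega>)"
    unfolding Suc.IH
    by (intro sum.cong refl) (simp add: Suc_diff_le funpow_swap1[of "\<lambda>x. x v* W"])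
  finally show ?case by simp
qed simp

lemma averaging_matrix_mult:
  fixes x :: "real^'n"
  shows "averaging_matrix *v x = ((1 \<bullet> x) / real CARD('n)) *\<^sub>R 1"
  by (simp add: vec_eq_iff averaging_matrix_def matrix_vector_mult_def inner_vec_def
      sum_divide_distrib)

lemma inner_one_averaging_matrix_mult:
  fixes x :: "real^'n"
  shows "1 \<bullet> (averaging_matrix *v x) = 1 \<bullet> x"
  unfolding averaging_matrix_mult by (simp add: inner_vec_def)

lemma inner_averaging_matrix_mult:
  fixes x y :: "real^'n"
  shows "(averaging_matrix *v x) \<bullet> y = (1 \<bullet> x) * (1 \<bullet> y) / real CARD('n)"
  unfolding averaging_matrix_mult by simp

lemma norm_funpow_le:
  fixes f :: "'a::real_normed_vector \<Rightarrow> 'a"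
  assumes "bounded_linear f"
  shows "norm ((f ^^ n) x) \<le> onorm f ^ n * norm x"
proof (induction n)
  case (Suc n)
  have "norm ((f ^^ Suc n) x) \<le> onorm f * norm ((f ^^ n) x)"
    using onorm[OF assms] by simp
  also have "\<dots> \<le> onorm f * (onorm f ^ n * norm x)"
    using Suc onorm_pos_le[OF assms] by (rule mult_left_mono)
  finally show ?case by (simp add: mult.assoc)
qed simp

lemma inner_one_funpow:
  fixes A :: "real^'n^'n"
  assumes "1 v* A = 1"
  shows "1 \<bullet> ((*v) A ^^ n) v = 1 \<bullet> v"
  by (induction n) (simp_all add: dot_lmul_matrix[symmetric] assms)

lemma funpow_diff_averaging_matrix:
  fixes A :: "real^'n^'n"
  assumes "A *v 1 = 1" and "1 v* A = 1"
  shows "((*v) A ^^ n) v - averaging_matrix *v v =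
    ((*v) (A - averaging_matrix) ^^ n) (v - averaging_matrix *v v)"
proof (induction n)
  case (Suc n)
  let ?J = "averaging_matrix :: real^'n^'n" and ?u = "((*v) A ^^ n) v"
  have mult_eqI: "?J *v x = ?J *v v" if "1 \<bullet> x = 1 \<bullet> v" for x
    by (simp add: averaging_matrix_mult that)
  have "A *v (?J *v v) = ?J *v v"
    by (simp add: averaging_matrix_mult matrix_vector_mult_scaleR assms)
  moreover have "?J *v ?u = ?J *v v"
    by (rule mult_eqI) (rule inner_one_funpow[OF assms(2)])
  moreover have "?J *v (?J *v v) = ?J *v v"
    by (rule mult_eqI) (rule inner_one_averaging_matrix_mult)
  ultimately have "A *v ?u - ?J *v v = (A - ?J) *v (?u - ?J *v v)"
    by (simp add: matrix_vector_mult_diff_rdistrib matrix_vector_mult_diff_distrib)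
  then show ?case
    by (simp add: Suc.IH)
qed simp

lemma norm_funpow_doubly_stochastic_le:
  fixes A :: "real^'n^'n"
  defines "r \<equiv> onorm ((*v) (A - averaging_matrix))"
  assumes "A *v 1 = 1" and "1 v* A = 1"
  shows "(norm (((*v) A ^^ n) v))\<^sup>2 \<le>
    (1 \<bullet> v)\<^sup>2 / real CARD('n) + (r\<^sup>2) ^ n * (norm (v - averaging_matrix *v v))\<^sup>2"
proof -
  let ?Jv = "averaging_matrix *v v" and ?u = "((*v) A ^^ n) v"
  have "orthogonal ?Jv (?u - ?Jv)"
    by (simp add: orthogonal_def inner_averaging_matrix_mult inner_diff_right inner_one_funpow
        inner_one_averaging_matrix_mult assms)
  then have "(norm ?u)\<^sup>2 = (norm ?Jv)\<^sup>2 + (norm (?u - ?Jv))\<^sup>2"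
    using norm_add_Pythagorean[of ?Jv "?u - ?Jv"] by simp
  also have "(norm ?Jv)\<^sup>2 = (1 \<bullet> v)\<^sup>2 / real CARD('n)"
    unfolding power2_norm_eq_inner inner_averaging_matrix_mult inner_one_averaging_matrix_mult
    by (simp add: power2_eq_square)
  finally have pythagoras: "(norm ?u)\<^sup>2 = (1 \<bullet> v)\<^sup>2 / real CARD('n) + (norm (?u - ?Jv))\<^sup>2" .
  have "norm (?u - ?Jv) \<le> r ^ n * norm (v - ?Jv)"
    unfolding funpow_diff_averaging_matrix[OF assms(2,3)] r_def
    by (rule norm_funpow_le) (simp add: linear_linear)
  then have "(norm (?u - ?Jv))\<^sup>2 \<le> (r ^ n * norm (v - ?Jv))\<^sup>2"
    by (rule power_mono) simp
  then show ?thesis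
    by (simp add: pythagoras power_mult_distrib power_mult[symmetric] mult.commute)
qed

lemma sum_norm_funpow_doubly_stochastic_le:
  fixes A :: "real^'n^'n"
  defines "r \<equiv> onorm ((*v) (A - averaging_matrix))"
  assumes "A *v 1 = 1" and "1 v* A = 1" and "r < 1"
  shows "(\<Sum>n = 1..t. (norm (((*v) A ^^ n) v))\<^sup>2) \<le>
    (1 \<bullet> v)\<^sup>2 / real CARD('n) * real t + (norm (v - averaging_matrix *v v))\<^sup>2 / (1 - r\<^sup>2)"
proof -
  let ?d = "(norm (v - averaging_matrix *v v))\<^sup>2"
  have "0 \<le> r"
    unfolding r_def by (rule onorm_pos_le) (simp add: linear_linear)
  with \<open>r < 1\<close> have "r\<^sup>2 < 1"
    by (simp add: power_less_one_iff)
  then have geometric: "(\<Sum>n = 1..t. (r\<^sup>2) ^ n) \<le> 1 / (1 - r\<^sup>2)"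
    using sum_le_suminf[of "\<lambda>n. (r\<^sup>2) ^ n" "{1..t}"] by (simp add: suminf_geometric)
  have "(\<Sum>n = 1..t. (norm (((*v) A ^^ n) v))\<^sup>2) \<le>
      (\<Sum>n = 1..t. (1 \<bullet> v)\<^sup>2 / real CARD('n) + (r\<^sup>2) ^ n * ?d)"
    unfolding r_def by (intro sum_mono norm_funpow_doubly_stochastic_le assms)
  also have "\<dots> = (1 \<bullet> v)\<^sup>2 / real CARD('n) * real t + (\<Sum>n = 1..t. (r\<^sup>2) ^ n) * ?d"
    by (simp add: sum.distrib sum_distrib_right)
  also have "(\<Sum>n = 1..t. (r\<^sup>2) ^ n) * ?d \<le> 1 / (1 - r\<^sup>2) * ?d"
    by (rule mult_right_mono[OF geometric]) simp
  finally show ?thesis by simp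
qed

definition (in prob_space) iid_normal_entries ::
  "real \<Rightarrow> real \<Rightarrow> (nat \<Rightarrow> 'a \<Rightarrow> real^'n) \<Rightarrow> bool" where
  "iid_normal_entries m \<tau> \<eta> \<longleftrightarrow>
     indep_vars (\<lambda>_. borel) (\<lambda>(j, s) \<omega>. \<eta> s \<omega> $ j) (UNIV \<times> {1..}) \<and>
     (\<forall>j. \<forall>s\<ge>1. distributed M lborel (\<lambda>\<omega>. \<eta> s \<omega> $ j) (normal_density m \<tau>))"

lemma iid_normal_entries_llr:
  assumes obs: "gaussian_observations P \<mu> \<sigma> y" and \<theta>: "\<theta> \<in> {0, 1}"
    and "\<mu> \<noteq> 0" and "\<sigma> > 0"
  shows "prob_space.iid_normal_entries (P \<theta>)
    (2 * \<mu> * hyp_mean \<mu> \<theta> / \<sigma>\<^sup>2) (2 * \<bar>\<mu>\<bar> / \<sigma>) (llr \<mu> \<sigma> y)"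
proof -
  interpret prob_space "P \<theta>"
    using obs \<theta> unfolding gaussian_observations_def by blast
  let ?noise = "\<lambda>j s \<omega>. y j s \<omega> - hyp_mean \<mu> \<theta>"
  let ?affine = "\<lambda>x. 2 * \<mu> * hyp_mean \<mu> \<theta> / \<sigma>\<^sup>2 + 2 * \<mu> / \<sigma>\<^sup>2 * x"
  have llr: "llr \<mu> \<sigma> y s \<omega> $ j = ?affine (?noise j s \<omega>)" for j s \<omega>
    using \<open>\<sigma> > 0\<close> by (simp add: llr_def field_simps)
  have "indep_vars (\<lambda>_. borel) (\<lambda>(j, s). ?noise j s) (UNIV \<times> {1..})"
    using obs \<theta> unfolding gaussian_observations_def by blast
  then have "indep_vars (\<lambda>_. borel) (\<lambda>p \<omega>. ?affine ((\<lambda>(j, s). ?noise j s) p \<omega>)) (UNIV \<times> {1..})"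
    by (rule indep_vars_compose2) measurable
  then have "indep_vars (\<lambda>_. borel) (\<lambda>(j, s) \<omega>. llr \<mu> \<sigma> y s \<omega> $ j) (UNIV \<times> {1..})"
    by (simp add: llr case_prod_unfold)
  moreover have "distributed (P \<theta>) lborel (\<lambda>\<omega>. llr \<mu> \<sigma> y s \<omega> $ j)
      (normal_density (2 * \<mu> * hyp_mean \<mu> \<theta> / \<sigma>\<^sup>2) (2 * \<bar>\<mu>\<bar> / \<sigma>))" if "s \<ge> 1" for j s
  proof -
    have "distributed (P \<theta>) lborel (?noise j s) (normal_density 0 \<sigma>)"
      using obs \<theta> that unfolding gaussian_observations_def by blast
    from normal_density_affine[OF this \<open>\<sigma> > 0\<close>, of "2 * \<mu> / \<sigma>\<^sup>2" "2 * \<mu> * hyp_mean \<mu> \<theta> / \<sigma>\<^sup>2"]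
    show ?thesis
      using \<open>\<mu> \<noteq> 0\<close> \<open>\<sigma> > 0\<close> by (simp add: llr abs_mult power2_eq_square)
  qed
  ultimately show ?thesis
    by (simp add: iid_normal_entries_def)
qed

context prob_space
begin

lemma borel_measurable_inner_dist_stat:
  assumes "iid_normal_entries m \<tau> \<eta>"
  shows "(\<lambda>\<omega>. v \<bullet> dist_stat W \<eta> t \<omega>) \<in> borel_measurable M"
proof -
  have "(\<lambda>\<omega>. \<eta> s \<omega> $ j) \<in> borel_measurable M" if "s \<ge> 1" for s j
    using assms that distributed_measurable[of M lborel "\<lambda>\<omega>. \<eta> s \<omega> $ j"]
    unfolding iid_normal_entries_def measurable_lborel1 by blast
  then show ?thesis
    unfolding inner_dist_stat
    by (auto simp: inner_vec_def intro!: borel_measurable_sum borel_measurable_times)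
qed

lemma Chernoff_inner_dist_stat_le:
  fixes W :: "real^'n^'n" and v :: "real^'n"
  defines "u \<equiv> \<lambda>n. ((\<lambda>x. x v* W) ^^ n) v"
  assumes \<eta>: "iid_normal_entries m \<tau> \<eta>" and "\<tau> > 0" and "l > 0"
  shows "prob {\<omega> \<in> space M. v \<bullet> dist_stat W \<eta> t \<omega> \<le> c} \<le>
    exp (l * (c - m * (\<Sum>n = 1..t. 1 \<bullet> u n)) + (l * \<tau>)\<^sup>2 / 2 * (\<Sum>n = 1..t. (norm (u n))\<^sup>2))"
proof -
  let ?I = "(UNIV :: 'n set) \<times> {1..t}"
  define a where "a = (\<lambda>(j, s). u (Suc t - s) $ j)"
  define X where "X = (\<lambda>(j, s) \<omega>. \<eta> s \<omega> $ j)"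
  have reverse: "(\<Sum>s = 1..t. f (Suc t - s)) = (\<Sum>n = 1..t. f n)" for f :: "nat \<Rightarrow> real"
    using sum.atLeastAtMost_rev[of f 1 t] by simp
  have sum_I: "(\<Sum>p\<in>?I. f p) = (\<Sum>s = 1..t. \<Sum>j\<in>UNIV. f (j, s))" for f :: "'n \<times> nat \<Rightarrow> real"
    by (subst sum.swap) (simp add: sum.cartesian_product case_prod_unfold)
  have stat: "v \<bullet> dist_stat W \<eta> t \<omega> = (\<Sum>p\<in>?I. a p * X p \<omega>)" for \<omega>
    unfolding inner_dist_stat sum_I by (simp add: inner_vec_def a_def X_def u_def)
  have mean: "(\<Sum>p\<in>?I. a p * m) = m * (\<Sum>n = 1..t. 1 \<bullet> u n)"
    unfolding reverse[of "\<lambda>n. 1 \<bullet> u n", symmetric] sum_I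
    by (simp add: a_def inner_vec_def sum_distrib_left mult.commute)
  have variance: "(\<Sum>p\<in>?I. (a p * \<tau>)\<^sup>2) = \<tau>\<^sup>2 * (\<Sum>n = 1..t. (norm (u n))\<^sup>2)"
    unfolding reverse[of "\<lambda>n. (norm (u n))\<^sup>2", symmetric] sum_I
    unfolding power2_norm_eq_inner
    by (simp add: a_def inner_vec_def sum_distrib_left power2_eq_square ac_simps)
  have "indep_vars (\<lambda>_. borel) X (UNIV \<times> {1..})"
    using \<eta> by (simp add: iid_normal_entries_def X_def)
  then have "indep_vars (\<lambda>_. borel) X ?I"
    by (rule indep_vars_subset) auto
  moreover have "distributed M lborel (X p) (normal_density m \<tau>)" if "p \<in> ?I" for p
    using \<eta> that by (auto simp: iid_normal_entries_def X_def)
  ultimately have "prob {\<omega> \<in> space M. (\<Sum>p\<in>?I. a p * X p \<omega>) \<le> c} \<le>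
      exp (l * (c - (\<Sum>p\<in>?I. a p * m)) + l\<^sup>2 / 2 * (\<Sum>p\<in>?I. (a p * \<tau>)\<^sup>2))"
    using \<open>\<tau> > 0\<close> \<open>l > 0\<close> by (intro Chernoff_indep_normal_le) auto
  then show ?thesis
    unfolding stat mean variance by (simp add: power_mult_distrib mult.assoc)
qed

lemma dist_stat_lower_tail_exponential:
  fixes W :: "real^'n^'n"
  assumes sym: "transpose W = W" and row: "W *v 1 = 1"
    and contraction: "onorm ((*v) (W - averaging_matrix)) < 1"
    and \<eta>: "iid_normal_entries m \<tau> \<eta>" and "m > 0" and "\<tau> > 0" and v: "1 \<bullet> v = 1"
  shows "\<exists>C. \<forall>t. prob {\<omega> \<in> space M. v \<bullet> dist_stat W \<eta> t \<omega> \<le> c} \<le>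
    exp (C + - (real CARD('n) * m\<^sup>2 / (2 * \<tau>\<^sup>2)) * real t)"
proof -
  define N where "N = real CARD('n)"
  define D where "D = (norm (v - averaging_matrix *v v))\<^sup>2 /
    (1 - (onorm ((*v) (W - averaging_matrix)))\<^sup>2)"
  \<comment> \<open>minimises the leading term \<open>(l\<^sup>2 \<tau>\<^sup>2 / (2 N) - l m) t\<close> of the Chernoff exponent\<close>
  define l where "l = N * m / \<tau>\<^sup>2"
  have "N > 0" "l > 0"
    using \<open>m > 0\<close> \<open>\<tau> > 0\<close> by (simp_all add: N_def l_def)
  have mult_W: "(\<lambda>x. x v* W) = (*v) W"
    by (simp only: transpose_matrix_vector[of W, symmetric] sym)
  have col: "1 v* W = 1"
    using row fun_cong[OF mult_W, of 1] by simp
  have energy: "(\<Sum>n = 1..t. (norm (((*v) W ^^ n) v))\<^sup>2) \<le> 1 / N * real t + D" for t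
    using sum_norm_funpow_doubly_stochastic_le[OF row col contraction, of v t]
    by (simp add: v N_def D_def)
  have "prob {\<omega> \<in> space M. v \<bullet> dist_stat W \<eta> t \<omega> \<le> c} \<le>
      exp (l * c + (l * \<tau>)\<^sup>2 / 2 * D + - (N * m\<^sup>2 / (2 * \<tau>\<^sup>2)) * real t)" for t
  proof -
    have "prob {\<omega> \<in> space M. v \<bullet> dist_stat W \<eta> t \<omega> \<le> c} \<le>
        exp (l * (c - m * real t) + (l * \<tau>)\<^sup>2 / 2 * (\<Sum>n = 1..t. (norm (((*v) W ^^ n) v))\<^sup>2))"
      using Chernoff_inner_dist_stat_le[OF \<eta> \<open>\<tau> > 0\<close> \<open>l > 0\<close>, of v W t c]
      by (simp add: mult_W inner_one_funpow[OF col] v)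
    also have "\<dots> \<le> exp (l * (c - m * real t) + (l * \<tau>)\<^sup>2 / 2 * (1 / N * real t + D))"
      unfolding exp_le_cancel_iff by (intro add_left_mono mult_left_mono energy) simp
    also have "l * (c - m * real t) + (l * \<tau>)\<^sup>2 / 2 * (1 / N * real t + D) =
        l * c + (l * \<tau>)\<^sup>2 / 2 * D + - (N * m\<^sup>2 / (2 * \<tau>\<^sup>2)) * real t"
      using \<open>N > 0\<close> \<open>\<tau> > 0\<close> by (simp add: l_def field_simps power2_eq_square)
    finally show ?thesis .
  qed
  then show ?thesis
    unfolding N_def by blast
qed

lemma prob_not_stopped_le:
  assumes S: "(\<lambda>\<omega>. S t \<omega> $ i) \<in> borel_measurable M" and "t \<ge> 1"
  shows "prob {\<omega> \<in> space M. agent_stopping_time S \<gamma>l \<gamma>h i \<omega> > enat t} \<le>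
    prob {\<omega> \<in> space M. S t \<omega> $ i \<le> \<gamma>h i}"
proof (rule finite_measure_mono)
  have "agent_stopping_time S \<gamma>l \<gamma>h i \<omega> \<le> enat t" if "S t \<omega> $ i > \<gamma>h i" for \<omega>
    unfolding agent_stopping_time_def using that \<open>t \<ge> 1\<close> by (intro Inf_lower) auto
  then show "{\<omega> \<in> space M. agent_stopping_time S \<gamma>l \<gamma>h i \<omega> > enat t} \<subseteq>
      {\<omega> \<in> space M. S t \<omega> $ i \<le> \<gamma>h i}"
    by (auto simp: not_less[symmetric])
qed (use S in measurable)

end

lemma limsup_elog_div_le:
  assumes "\<forall>\<^sub>F t in sequentially. p t \<le> exp (c + d * real t)"
  shows "limsup (\<lambda>t. ereal (1 / real t) * elog (p t)) \<le> ereal d"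
proof -
  have pointwise: "ereal (1 / real t) * elog (p t) \<le> ereal (c / real t + d)"
    if "p t \<le> exp (c + d * real t)" and "t > 0" for t
  proof (cases "p t \<le> 0")
    case False
    then have "ln (p t) \<le> c + d * real t"
      using that(1) by (metis ln_exp ln_mono exp_gt_zero not_le)
    then have "1 / real t * ln (p t) \<le> c / real t + d"
      using that(2) by (simp add: field_simps)
    then show ?thesis
      using False by (simp add: elog_def)
  qed (use that in \<open>simp add: elog_def\<close>)
  have "\<forall>\<^sub>F t in sequentially. ereal (1 / real t) * elog (p t) \<le> ereal (c / real t + d)"
    using assms eventually_gt_at_top[of 0] by eventually_elim (rule pointwise)
  then have "limsup (\<lambda>t. ereal (1 / real t) * elog (p t)) \<le> limsup (\<lambda>t. ereal (c / real t + d))"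
    by (rule Limsup_mono)
  also have "\<dots> = ereal d"
  proof (rule lim_imp_Limsup)
    show "(\<lambda>t. ereal (c / real t + d)) \<longlonglongrightarrow> ereal d"
      using tendsto_add[OF lim_const_over_n[of c] tendsto_const[of d]] by simp
  qed simp
  finally show ?thesis .
qed

theorem theorem4p6:
  fixes P :: "nat \<Rightarrow> 'a measure"
    and y :: "'n::finite \<Rightarrow> nat \<Rightarrow> 'a \<Rightarrow> real"
    and E :: "('n \<times> 'n) set"
    and W :: "real^'n^'n"
    and \<mu> \<sigma> m N r k \<alpha> \<beta> :: real
    and \<gamma>l \<gamma>h :: "'n \<Rightarrow> real"
  assumes "\<mu> \<noteq> 0" and "\<sigma> > 0"
    and "gaussian_observations P \<mu> \<sigma> y"
    and "connected_simple_graph E"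
    and "consensus_weights E W"
    and "N = real CARD('n)"
    and "m = 2 * \<mu>\<^sup>2 / \<sigma>\<^sup>2"
    and "r = onorm ((*v) (W - averaging_matrix))"
    and "r < 1"
    and "k = N * r\<^sup>2"
    and "\<alpha> \<in> {0<..<1/2}" and "\<beta> \<in> {0<..<1/2}"
    and "\<forall>i. \<gamma>h i \<ge> 8 * (k + 1) / (7 * N) *
               (ln (2 / \<alpha>) - ln (1 - exp (- (N * m / (4 * (k + 1))))))"
    and "\<forall>i. \<gamma>l i \<le> 8 * (k + 1) / (7 * N) *
               (ln (\<beta> / 2) + ln (1 - exp (- (N * m / (4 * (k + 1))))))"
  shows "\<forall>i. limsup (\<lambda>t. ereal (1 / real t) *
               elog (measure (P 1) {\<omega> \<in> space (P 1).
                 agent_stopping_time (dist_stat W (llr \<mu> \<sigma> y)) \<gamma>l \<gamma>h i \<omega> > enat t}))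
             \<le> ereal (- (N * m / 4))"
proof
  fix i :: 'n
  interpret prob_space "P 1"
    using assms(3) by (simp add: gaussian_observations_def)
  let ?\<tau> = "2 * \<bar>\<mu>\<bar> / \<sigma>" and ?S = "dist_stat W (llr \<mu> \<sigma> y)"
  let ?T = "agent_stopping_time ?S \<gamma>l \<gamma>h i"
  have "m > 0" "?\<tau> > 0"
    using assms(1,2) by (simp_all add: assms(7))
  have rate: "N * m\<^sup>2 / (2 * ?\<tau>\<^sup>2) = N * m / 4"
    using assms(1,2) by (simp add: assms(7) field_simps power2_eq_square)
  have llr: "iid_normal_entries m ?\<tau> (llr \<mu> \<sigma> y)"
    using iid_normal_entries_llr[OF assms(3) _ assms(1,2), of 1]
    by (simp add: hyp_mean_def assms(7) power2_eq_square mult.assoc)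
  have "transpose W = W" "W *v 1 = 1" "onorm ((*v) (W - averaging_matrix)) < 1"
    using assms(5,8,9) by (simp_all add: consensus_weights_def vec_eq_iff matrix_vector_mult_def)
  from dist_stat_lower_tail_exponential[OF this llr \<open>m > 0\<close> \<open>?\<tau> > 0\<close>, of "axis i 1" "\<gamma>h i"]
  obtain C where tail:
    "prob {\<omega> \<in> space (P 1). ?S t \<omega> $ i \<le> \<gamma>h i} \<le> exp (C + - (N * m / 4) * real t)" for t
    unfolding assms(6)[symmetric] rate by (auto simp: inner_axis inner_axis')
  have "(\<lambda>\<omega>. ?S t \<omega> $ i) \<in> borel_measurable (P 1)" for t
    using borel_measurable_inner_dist_stat[OF llr, of "axis i 1"] by (simp add: inner_axis')
  then have "prob {\<omega> \<in> space (P 1). ?T \<omega> > enat t} \<le> exp (C + - (N * m / 4) * real t)"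
    if "t \<ge> 1" for t
    using prob_not_stopped_le[OF _ that] tail order_trans by blast
  then show "limsup (\<lambda>t. ereal (1 / real t) *
      elog (prob {\<omega> \<in> space (P 1). ?T \<omega> > enat t})) \<le> ereal (- (N * m / 4))"
    by (intro limsup_elog_div_le eventually_sequentiallyI)
qed

end
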